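(* Let $q$ be a prime power and $n\ge 1$. For $f\in\mathrm{Per}(\mathbb{F}_q^n)$ and $0\le k\le n$, let $k\text{-affinity}(f)$ be the number of $k$-flats $X$ of $\mathbb{F}_q^n$ such that $f(X)$ is also a $k$-flat. Then: (i) If $q=2$ and $n\ge 3$ is odd, there exists $f\in\mathrm{Per}(\mathbb{F}_2^n)$ with $2\text{-affinity}(f)=0$. (ii) If $q=2$ and $n\ge 4$, there exists $f\in\mathrm{Per}(\mathbb{F}_2^n)$ with $k\text{-affinity}(f)=0$ for all $3\le k\le n-1$. (iii) If $q\ge 4$ and $n\ge 2$, there exists $f\in\mathrm{Per}(\mathbb{F}_q^n)$ with $k\text{-affinity}(f)=0$ for all $1\le k\le n-1$. (iv) If $q=3$ and $n\ge 3$, there exists $f\in\mathrm{Per}(\mathbb{F}_3^n)$ with $k\text{-affinity}(f)=0$ for all $2\le k\le n-1$. (v) If $q=3$ and $n\ge 2$, there exists $f\in\mathrm{Per}(\mathbb{F}_3^n)$ with $1\text{-affinity}(f)=0$.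
   Context: $\mathbb{F}_q$ is the finite field with $q$ elements, $\mathbb{F}_q^n$ the $n$-dimensional vector space over it, and $\mathrm{Per}(\mathbb{F}_q^n)$ the group of all permutations (bijections) of $\mathbb{F}_q^n$. A $k$-flat of $\mathbb{F}_q^n$ is a coset $U+x$ of a $k$-dimensional linear subspace $U$. *)

theory Defs
  imports "HOL-Analysis.Cartesian_Space"
begin

definition is_flat :: "nat \<Rightarrow> ('a::field ^ 'n) set \<Rightarrow> bool" where
  "is_flat k X \<longleftrightarrow>
     (\<exists>U x. vec.subspace U \<and> vec.dim U = k \<and> X = (\<lambda>u. u + x) ` U)"

text \<open>Over a finite field the set below is finite, so \<open>card\<close> is a genuine count.\<close>

definition affinity :: "nat \<Rightarrow> ('a::{field,finite} ^ 'n \<Rightarrow> 'a ^ 'n) \<Rightarrow> nat" where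
  "affinity k f = card {X. is_flat k X \<and> is_flat k (f ` X)}"

end

theory Submission
  imports Defs "HOL-Combinatorics.Permutations" "HOL-Algebra.Algebraic_Closure_Type"
    "HOL-Number_Theory.Residues"
begin

text \<open>
  Parts (ii)--(iv) are a union bound over a random permutation. Put \<open>N = q^n\<close>, \<open>Q = q^k\<close> and
  \<open>r i = (N - i) / (Q - i)\<close>, which increases with \<open>i\<close>. The number of \<open>k\<close>-flats is
  \<open>r 0 * r 1 * r q * ... * r (q^(k-1))\<close>, while \<open>N choose Q\<close> is the product of all \<open>r i\<close> with \<open>i < Q\<close>.
  Hence in \<open>(number of k-flats)^2 / (N choose Q)\<close>, the expected number of \<open>k\<close>-flats mapped to
  \<open>k\<close>-flats, the \<open>k + 1\<close> factors in the numerator are outweighed by \<open>k + 1\<close> larger ones in the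
  denominator, and each remaining factor of the denominator is at least \<open>q\<close>. The expectations
  turn out to have sum less than 1.

  For (i) and (v), identify \<open>F_q^n\<close> with the field of order \<open>q^n\<close>. Planes over \<open>F_2\<close> are the
  4-sets with sum 0 and lines over \<open>F_3\<close> are the 3-sets with sum 0. In (i) take \<open>x^3\<close>. In (v),
  inversion destroys all lines except those through 0; these are repaired by cyclically permuting
  the values at 0, 1 and \<open>b\<close>, where \<open>1 - b\<close> is a nonsquare other than \<open>-1\<close>.
\<close>

section \<open>Counting flats and permutations\<close>

text \<open>Adjoining \<open>b\<close> outside \<open>span B\<close> makes \<open>(k, y)\<close>
  correspond bijectively to \<open>k b + y\<close>, so each basis vector multiplies the size by that
  of the field. Proved for abstract vector spaces because it serves both coordinate vectors and an
  algebraic closure seen as a vector space over \<open>'a\<close>.\<close>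

lemma (in vector_space) card_span_independent:
  assumes "finite B" "independent B" "finite (UNIV :: 'a set)"
  shows "card (span B) = CARD('a) ^ card B"
  using assms(1,2)
proof (induction B rule: finite_induct)
  case empty
  then show ?case by simp
next
  case (insert b B)
  have ind: "independent B" and b: "b \<notin> span B"
    using insert.prems insert.hyps by (auto simp: independent_insert)
  let ?h = "\<lambda>(k, y). scale k b + y"
  have "inj_on ?h (UNIV \<times> span B)"
  proof (rule inj_onI, clarify)
    fix k y k' y'
    assume y: "y \<in> span B" "y' \<in> span B" and eq: "scale k b + y = scale k' b + y'"
    have *: "scale (k - k') b = y' - y"
      using eq by (simp add: algebra_simps)
    have "scale (k - k') b \<in> span B"
      unfolding * using y by (simp add: span_diff)
    then have "scale (inverse (k - k')) (scale (k - k') b) \<in> span B"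
      by (rule span_scale)
    with b have "k = k'"
      by (cases "k = k'") auto
    with eq show "k = k' \<and> y = y'"
      by simp
  qed
  moreover have "span (insert b B) = ?h ` (UNIV \<times> span B)"
  proof (intro Set.set_eqI iffI)
    fix x assume "x \<in> span (insert b B)"
    then obtain k where "x - scale k b \<in> span B"
      by (auto simp: span_insert)
    then show "x \<in> ?h ` (UNIV \<times> span B)"
      by (intro image_eqI[of _ _ "(k, x - scale k b)"]) auto
  next
    fix x assume "x \<in> ?h ` (UNIV \<times> span B)"
    then obtain k y where "x = scale k b + y" "y \<in> span B"
      by auto
    then show "x \<in> span (insert b B)"
      by (auto simp: span_insert intro!: exI[of _ k])
  qed
  ultimately have "card (span (insert b B)) = CARD('a) * card (span B)"
    by (simp add: card_image card_cartesian_product)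
  with insert ind show ?case by simp
qed

lemma card_subspace:
  fixes U :: "('a::{field,finite} ^ 'n) set"
  assumes "vec.subspace U"
  shows "card U = CARD('a) ^ vec.dim U"
proof -
  obtain B where B: "B \<subseteq> U" "vec.independent B" "U \<subseteq> vec.span B" "card B = vec.dim U"
    by (rule vec.basis_exists)
  have "vec.span B = U"
    using B assms by (simp add: vec.span_minimal subset_antisym)
  then show ?thesis
    using vec.card_span_independent[of B] B by simp
qed

lemma card_flat:
  fixes Z :: "('a::{field,finite} ^ 'n) set"
  assumes "is_flat k Z"
  shows "card Z = CARD('a) ^ k"
  using assms unfolding is_flat_def
  by (auto simp: card_image card_subspace)

text \<open>Ordered tuples rather than sets, so that they can be counted by adding one vector at a
  time.\<close>

definition independent_lists :: "('a::{field,finite} ^ 'n) set \<Rightarrow> nat \<Rightarrow> ('a ^ 'n) list set" where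
  "independent_lists U k =
     {xs. set xs \<subseteq> U \<and> length xs = k \<and> distinct xs \<and> vec.independent (set xs)}"

lemma finite_independent_lists [simp]: "finite (independent_lists U k)"
  by (rule finite_subset[OF _ finite_lists_length_eq[of U k]])
     (auto simp: independent_lists_def)

text \<open>An independent list of length \<open>k\<close> extends by any vector of \<open>U\<close>
  outside its span, which has \<open>q^k\<close> elements. For \<open>k\<close> above the dimension
  one factor is 0, as it should be.\<close>

lemma card_independent_lists:
  fixes U :: "('a::{field,finite} ^ 'n) set"
  assumes U: "vec.subspace U"
  shows "card (independent_lists U k) = (\<Prod>i<k. CARD('a) ^ vec.dim U - CARD('a) ^ i)"
proof (induction k)
  case 0
  have "independent_lists U 0 = {[]}"
    by (auto simp: independent_lists_def vec.independent_empty)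
  then show ?case by simp
next
  case (Suc k)
  have eq: "independent_lists U (Suc k) =
      (\<lambda>(xs, x). x # xs) ` (SIGMA xs : independent_lists U k. U - vec.span (set xs))"
    (is "_ = ?g ` ?S")
  proof (intro Set.set_eqI iffI)
    fix ys assume "ys \<in> independent_lists U (Suc k)"
    then obtain x xs where "ys = x # xs" "(xs, x) \<in> ?S"
      by (cases ys) (auto simp: independent_lists_def vec.independent_insert)
    then show "ys \<in> ?g ` ?S" by force
  next
    fix ys assume "ys \<in> ?g ` ?S"
    then show "ys \<in> independent_lists U (Suc k)"
      by (auto simp: independent_lists_def vec.span_base dest: vec.independent_insertI)
  qed
  have "card (U - vec.span (set xs)) = CARD('a) ^ vec.dim U - CARD('a) ^ k"
    if "xs \<in> independent_lists U k" for xs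
  proof -
    have xs: "set xs \<subseteq> U" "vec.independent (set xs)" "card (set xs) = k"
      using that by (auto simp: independent_lists_def distinct_card)
    have "card (vec.span (set xs)) = CARD('a) ^ k"
      using vec.card_span_independent[of "set xs"] xs by simp
    moreover have "vec.span (set xs) \<subseteq> U"
      using xs U by (simp add: vec.span_minimal)
    ultimately show ?thesis
      using card_subspace[OF U] by (simp add: card_Diff_subset)
  qed
  then have "card ?S = card (independent_lists U k) * (CARD('a) ^ vec.dim U - CARD('a) ^ k)"
    by (simp add: card_SigmaI)
  moreover have "inj_on ?g ?S"
    by (auto simp: inj_on_def)
  ultimately show ?case
    by (simp add: eq card_image Suc.IH)
qed

text \<open>Double counting of pairs of a base point and an ordered basis of the direction space.
  Each pair determines its flat, and each flat has at least \<open>q^k\<close> times the number of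
  ordered bases of \<open>F_q^k\<close> such pairs. The product form avoids division in
  \<open>nat\<close>.\<close>

lemma card_flats_le:
  "card {Z :: ('a::{field,finite} ^ 'n) set. is_flat k Z} *
           (CARD('a) ^ k * (\<Prod>i<k. CARD('a) ^ k - CARD('a) ^ i)) \<le>
         CARD('a) ^ CARD('n) * (\<Prod>i<k. CARD('a) ^ CARD('n) - CARD('a) ^ i)"
proof -
  let ?F = "{Z :: ('a ^ 'n) set. is_flat k Z}"
  let ?L = "independent_lists (UNIV :: ('a ^ 'n) set) k"
  define frames where
    "frames Z = {(x, xs). xs \<in> ?L \<and> Z = (\<lambda>u. u + x) ` vec.span (set xs)}" for Z
  have sub: "frames Z \<subseteq> UNIV \<times> ?L" for Z
    by (auto simp: frames_def)
  have fin: "finite (frames Z)" for Z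
    by (rule finite_subset[OF sub]) simp
  have lower: "CARD('a) ^ k * (\<Prod>i<k. CARD('a) ^ k - CARD('a) ^ i) \<le> card (frames Z)"
    if Z: "Z \<in> ?F" for Z
  proof -
    obtain U x0 where U: "vec.subspace U" "vec.dim U = k" "Z = (\<lambda>u. u + x0) ` U"
      using Z by (auto simp: is_flat_def)
    \<comment> \<open>Every point of the flat can serve as base point, and every independent list of
      length \<open>k\<close> in \<open>U\<close> spans \<open>U\<close>.\<close>
    have "Z \<times> independent_lists U k \<subseteq> frames Z"
    proof clarify
      fix x xs assume x: "x \<in> Z" and xs: "xs \<in> independent_lists U k"
      have s: "set xs \<subseteq> U" "vec.independent (set xs)" "card (set xs) = k"
        using xs by (auto simp: independent_lists_def distinct_card)
      have "vec.span (set xs) = U"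
        using s U by (metis vec.card_eq_dim List.finite_set vec.span_minimal subset_antisym)
      moreover from x obtain u where u: "u \<in> U" "x = u + x0"
        using U by auto
      have "(\<lambda>u. u + x) ` U = Z"
      proof (intro Set.set_eqI iffI)
        fix y assume "y \<in> Z"
        then obtain v where v: "v \<in> U" "y = v + x0" using U by auto
        then have "y = (v - u) + x" "v - u \<in> U"
          using u U by (auto simp: vec.subspace_diff)
        then show "y \<in> (\<lambda>u. u + x) ` U" by blast
      next
        fix y assume "y \<in> (\<lambda>u. u + x) ` U"
        then obtain v where v: "v \<in> U" "y = v + x" by auto
        then have "y = (v + u) + x0" "v + u \<in> U"
          using u U by (auto simp: vec.subspace_add)
        then show "y \<in> Z" using U by blast
      qed
      ultimately show "(x, xs) \<in> frames Z"
        using xs by (auto simp: frames_def independent_lists_def)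
    qed
    then have "card (Z \<times> independent_lists U k) \<le> card (frames Z)"
      by (rule card_mono[OF fin])
    then show ?thesis
      using card_flat[of k Z] Z U by (simp add: card_cartesian_product card_independent_lists)
  qed
  have "card ?F * (CARD('a) ^ k * (\<Prod>i<k. CARD('a) ^ k - CARD('a) ^ i))
      \<le> (\<Sum>Z\<in>?F. card (frames Z))"
    using sum_mono[of ?F "\<lambda>_. CARD('a) ^ k * (\<Prod>i<k. CARD('a) ^ k - CARD('a) ^ i)"] lower
    by simp
  also have "\<dots> = card (\<Union>Z\<in>?F. frames Z)"
    using fin by (subst card_UN_disjoint) (auto simp: frames_def)
  also have "\<dots> \<le> card ((UNIV :: ('a ^ 'n) set) \<times> ?L)"
    using sub by (intro card_mono) auto
  also have "\<dots> = CARD('a) ^ CARD('n) * (\<Prod>i<k. CARD('a) ^ CARD('n) - CARD('a) ^ i)"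
    using card_independent_lists[OF vec.subspace_UNIV, where 'a = 'a and 'n = 'n, of k]
    by (simp add: card_cartesian_product card_cart_basis)
  finally show ?thesis .
qed

section \<open>Permutations with a prescribed image, and the union bound\<close>

text \<open>Composing with the inverse of one fixed such bijection \<open>p\<close> turns each
  \<open>f\<close> into a permutation that preserves \<open>Z\<close>, hence into a pair of
  permutations of \<open>Z\<close> and of its complement. If no \<open>p\<close> exists, the set is
  empty.\<close>

lemma card_bij_image_eq_le:
  fixes Z Y :: "'v::finite set"
  shows "card {f. bij f \<and> f ` Z = Y} \<le> fact (card Z) * fact (CARD('v) - card Z)"
proof (cases "\<exists>p. bij p \<and> p ` Z = Y")
  case False
  then have "{f. bij f \<and> f ` Z = Y} = {}" by blast
  then show ?thesis by (metis card.empty le0)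
next
  case True
  then obtain p where p: "bij p" "p ` Z = Y" by blast
  \<comment> \<open>Both restrictions are extended by the identity, as \<open>permutes\<close>
    demands.\<close>
  define h where "h f = (\<lambda>x. if x \<in> Z then inv_into UNIV p (f x) else x, \<lambda>x. if x \<in> - Z then inv_into UNIV p (f x) else x)"
    for f
  let ?A = "{f. bij f \<and> f ` Z = Y}" and ?B = "{g. g permutes Z} \<times> {g. g permutes - Z}"
  have "inj_on h ?A"
  proof (rule inj_onI)
    fix f g assume eq: "h f = h g"
    have "inv_into UNIV p (f x) = inv_into UNIV p (g x)" for x
      using eq unfolding h_def by (cases "x \<in> Z") (auto dest: fun_cong[where x = x])
    then show "f = g"
      using p by (metis bij_is_surj ext surj_f_inv_f)
  qed
  moreover have "h ` ?A \<subseteq> ?B"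
  proof (rule image_subsetI)
    fix f assume f: "f \<in> ?A"
    have "bij (inv_into UNIV p \<circ> f)"
      using f p by (intro bij_comp bij_imp_bij_inv) auto
    then have inj: "inj (\<lambda>x. inv_into UNIV p (f x))"
      by (simp add: bij_is_inj comp_def)
    have "(\<lambda>x. inv_into UNIV p (f x)) ` Z = inv_into UNIV p ` p ` Z"
      using f p by (auto simp flip: image_image)
    then have sZ: "(\<lambda>x. inv_into UNIV p (f x)) ` Z = Z"
      using p(1) by (simp add: bij_is_inj image_inv_f_f)
    have "(\<lambda>x. inv_into UNIV p (f x)) ` (- Z) \<subseteq> - Z"
    proof (clarify)
      fix x assume x: "x \<notin> Z" and m: "inv_into UNIV p (f x) \<in> Z"
      from m have "inv_into UNIV p (f x) \<in> (\<lambda>x. inv_into UNIV p (f x)) ` Z"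
        by (simp only: sZ)
      then obtain y where "y \<in> Z" "inv_into UNIV p (f y) = inv_into UNIV p (f x)" by force
      with inj x show False by (metis injD)
    qed
    moreover have b: "bij_betw (\<lambda>x. inv_into UNIV p (f x)) Z Z"
      using inj sZ by (metis bij_betw_def inj_on_subset subset_UNIV)
    ultimately have c: "bij_betw (\<lambda>x. inv_into UNIV p (f x)) (- Z) (- Z)"
      using inj by (metis bij_betw_def endo_inj_surj finite inj_on_subset subset_UNIV)
    have "bij_betw (fst (h f)) Z Z"
      using b by (subst bij_betw_cong[of _ _ "\<lambda>x. inv_into UNIV p (f x)"]) (auto simp: h_def)
    moreover have "bij_betw (snd (h f)) (- Z) (- Z)"
      using c by (subst bij_betw_cong[of _ _ "\<lambda>x. inv_into UNIV p (f x)"]) (auto simp: h_def)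
    ultimately have "fst (h f) permutes Z" "snd (h f) permutes - Z"
      by (auto intro!: bij_imp_permutes simp: h_def)
    then show "h f \<in> ?B"
      by (simp add: mem_Times_iff)
  qed
  ultimately have "card ?A \<le> card ?B"
    by (intro card_inj_on_le[of h]) (auto simp: finite_permutations)
  also have "\<dots> = fact (card Z) * fact (CARD('v) - card Z)"
    by (simp add: card_cartesian_product card_permutations Compl_eq_Diff_UNIV card_Diff_subset)
  finally show ?thesis .
qed

text \<open>A random permutation sends a given \<open>m\<close>-set to another given
  \<open>m\<close>-set with probability at most 1 over \<open>N choose m\<close>. Summed over all
  pairs in all families this stays below 1, so some permutation avoids every pair.\<close>

lemma exists_bij_avoiding:
  fixes F :: "'k \<Rightarrow> 'v::finite set set" and m :: "'k \<Rightarrow> nat"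
  assumes K: "finite K"
    and m: "\<And>k Z. k \<in> K \<Longrightarrow> Z \<in> F k \<Longrightarrow> card Z = m k"
    and le: "\<And>k. k \<in> K \<Longrightarrow> m k \<le> CARD('v)"
    and less: "(\<Sum>k\<in>K. real (card (F k)) ^ 2 / real (CARD('v) choose m k)) < 1"
  shows "\<exists>f. bij f \<and> (\<forall>k\<in>K. \<forall>Z\<in>F k. f ` Z \<notin> F k)"
proof (rule ccontr)
  assume neg: "\<not> ?thesis"
  let ?N = "CARD('v)"
  let ?P = "\<lambda>Z Y. {f :: 'v \<Rightarrow> 'v. bij f \<and> f ` Z = Y}"
  have "{f. bij f} \<subseteq> (\<Union>k\<in>K. \<Union>(Z, Y)\<in>F k \<times> F k. ?P Z Y)"
    using neg by blast
  then have "card {f :: 'v \<Rightarrow> 'v. bij f} \<le> card (\<Union>k\<in>K. \<Union>(Z, Y)\<in>F k \<times> F k. ?P Z Y)"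
    by (rule card_mono[OF finite])
  also have "\<dots> \<le> (\<Sum>k\<in>K. card (\<Union>(Z, Y)\<in>F k \<times> F k. ?P Z Y))"
    by (rule card_UN_le[OF K])
  also have "\<dots> \<le> (\<Sum>k\<in>K. \<Sum>(Z, Y)\<in>F k \<times> F k. card (?P Z Y))"
    by (intro sum_mono order_trans[OF card_UN_le]) (auto simp: case_prod_unfold)
  also have "\<dots> \<le> (\<Sum>k\<in>K. \<Sum>(Z, Y)\<in>F k \<times> F k. fact (m k) * fact (?N - m k))"
  proof (intro sum_mono, clarify)
    fix k Z Y assume "k \<in> K" "Z \<in> F k"
    then show "card (?P Z Y) \<le> fact (m k) * fact (?N - m k)"
      using card_bij_image_eq_le[of Z Y] m by simp
  qed
  also have "\<dots> = (\<Sum>k\<in>K. card (F k) ^ 2 * (fact (m k) * fact (?N - m k)))"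
    by (simp add: card_cartesian_product power2_eq_square case_prod_unfold)
  finally have "real (card {f :: 'v \<Rightarrow> 'v. bij f}) \<le>
      real (\<Sum>k\<in>K. card (F k) ^ 2 * (fact (m k) * fact (?N - m k)))"
    by (rule of_nat_mono)
  also have "\<dots> = (\<Sum>k\<in>K. real (card (F k)) ^ 2 * (fact (m k) * fact (?N - m k)))"
    by simp
  also have "\<dots> = (\<Sum>k\<in>K. fact ?N * (real (card (F k)) ^ 2 / real (?N choose m k)))"
    using le by (intro sum.cong) (auto simp: binomial_fact field_simps)
  also have "\<dots> < fact ?N"
    unfolding sum_distrib_left[symmetric] using less by simp
  finally show False
    using card_permutations[OF refl finite, where S = "UNIV :: 'v set"]
    by (simp add: permutes_univ bij_iff)
qed

section \<open>The expected number of preserved flats\<close>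

text \<open>After cross-multiplication the difference is \<open>(N - Q) * (j - i)\<close>.\<close>

lemma ratio_mono:
  fixes N Q i j :: nat
  assumes "i \<le> j" "j < Q" "Q \<le> N"
  shows "(real N - real i) / (real Q - real i) \<le> (real N - real j) / (real Q - real j)"
proof -
  have "(real N - real j) * (real Q - real i) - (real N - real i) * (real Q - real j)
      = (real N - real Q) * (real j - real i)"
    by (simp add: algebra_simps)
  also have "\<dots> \<ge> 0"
    using assms by simp
  finally show ?thesis
    using assms by (simp add: frac_le_eq divide_simps)
qed

text \<open>The index 0 carries the factor for the base point, the indices \<open>q^i\<close> those
  for the basis vectors. Indexing by a set of numbers makes this a subproduct of the product for
  \<open>q^n choose q^k\<close>.\<close>

lemma card_flats_le_prod:
  assumes "k \<le> CARD('n)" and q: "q = CARD('a::{field,finite})"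
  shows "real (card {Z :: ('a ^ 'n) set. is_flat k Z}) \<le>
    (\<Prod>i \<in> insert 0 ((\<lambda>i. q ^ i) ` {..<k}).
        (real (q ^ CARD('n)) - real i) / (real (q ^ k) - real i))"
    (is "real ?c \<le> _")
proof -
  have "2 \<le> q"
    using card_mono[of "UNIV :: 'a set" "{0, 1}"] q by simp
  then have q1: "1 < q" by simp
  let ?N = "real (q ^ CARD('n))" and ?Q = "real (q ^ k)"
  have inj: "inj_on (\<lambda>i. q ^ i) {..<k}"
    using q1 by (intro inj_onI) simp
  have N: "real (q ^ CARD('n) - q ^ i) = ?N - real (q ^ i)" if "i < k" for i
    using that assms q1 by (intro of_nat_diff power_increasing) auto
  have Q: "real (q ^ k - q ^ i) = ?Q - real (q ^ i)" if "i < k" for i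
    using that q1 by (intro of_nat_diff power_increasing) auto
  have pos: "0 < ?Q * (\<Prod>i<k. ?Q - real (q ^ i))"
    using q1 by (intro mult_pos_pos prod_pos) (auto simp: power_strict_increasing_iff simp flip: of_nat_power)
  have "real (?c * (q ^ k * (\<Prod>i<k. q ^ k - q ^ i))) \<le>
      real (q ^ CARD('n) * (\<Prod>i<k. q ^ CARD('n) - q ^ i))"
    using card_flats_le[where 'a = 'a and 'n = 'n, of k] unfolding q by (rule of_nat_mono)
  moreover have "(\<Prod>i<k. real (q ^ CARD('n) - q ^ i)) = (\<Prod>i<k. ?N - real (q ^ i))"
    using N by (intro prod.cong) auto
  moreover have "(\<Prod>i<k. real (q ^ k - q ^ i)) = (\<Prod>i<k. ?Q - real (q ^ i))"
    using Q by (intro prod.cong) auto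
  ultimately have "real ?c * (?Q * (\<Prod>i<k. ?Q - real (q ^ i))) \<le> ?N * (\<Prod>i<k. ?N - real (q ^ i))"
    by (simp only: of_nat_mult of_nat_prod)
  then have "real ?c \<le> ?N * (\<Prod>i<k. ?N - real (q ^ i)) / (?Q * (\<Prod>i<k. ?Q - real (q ^ i)))"
    using pos by (simp add: pos_le_divide_eq)
  also have "\<dots> = ?N / ?Q * (\<Prod>i<k. (?N - real (q ^ i)) / (?Q - real (q ^ i)))"
    by (simp add: prod_dividef)
  also have "\<dots> = (\<Prod>i \<in> insert 0 ((\<lambda>i. q ^ i) ` {..<k}). (?N - real i) / (?Q - real i))"
    using q1 by (subst prod.insert) (auto simp: prod.reindex[OF inj])
  finally show ?thesis .
qed

text \<open>The binomial is the product of \<open>r i\<close> over all \<open>i < q^k\<close>, split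
  into \<open>S\<close>, the top \<open>k + 1\<close> indices \<open>?T\<close>, and the rest
  \<open>?R\<close>. \<open>gap\<close> places \<open>?T\<close> above all of \<open>S\<close>, so
  the product over \<open>?T\<close> dominates a second copy of the product over \<open>S\<close>;
  \<open>large\<close> leaves at least \<open>k\<close> indices in \<open>?R\<close>, each with
  \<open>r i\<close> at least 2.\<close>

lemma prod_ratio_sq_le_binomial:
  fixes q k n :: nat
  assumes q: "2 \<le> q" and k: "1 \<le> k" "k < n"
    and gap: "k + 2 \<le> q ^ k - q ^ (k - 1)" and large: "3 * k + 2 \<le> q ^ k"
  defines "r \<equiv> \<lambda>i::nat. (real (q ^ n) - real i) / (real (q ^ k) - real i)"
  defines "S \<equiv> insert 0 ((\<lambda>i. q ^ i) ` {..<k})"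
  shows "(\<Prod>i\<in>S. r i)\<^sup>2 * 2 ^ k \<le> real (q ^ n choose q ^ k)"
proof -
  let ?N = "q ^ n" and ?Q = "q ^ k" and ?m = "q ^ (k - 1)"
  have NQ: "?Q * q \<le> ?N"
    using q k power_increasing[of "Suc k" n q] by (simp add: mult.commute)
  then have QN: "?Q \<le> ?N"
    using q by (metis One_nat_def Suc_1 Suc_leD le_trans mult.right_neutral mult_le_mono2)
  have mono: "r i \<le> r j" if "i \<le> j" "j < ?Q" for i j
    unfolding r_def using ratio_mono[OF that QN] .
  have r2: "2 \<le> r i" if "i < ?Q" for i
  proof -
    have "2 * ?Q \<le> ?N"
      using NQ q by (metis le_trans mult.commute mult_le_mono2)
    then have "2 * real ?Q \<le> real ?N"
      by (metis of_nat_le_iff of_nat_mult of_nat_numeral)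
    then have "2 \<le> r 0"
      using q by (simp add: r_def pos_le_divide_eq)
    also have "\<dots> \<le> r i"
      using that by (intro mono) auto
    finally show ?thesis .
  qed
  let ?T = "{?Q - k - 1..<?Q}"
  have m_less: "?m < ?Q - k - 1"
    using gap by linarith
  have S_le: "i \<le> ?m" if "i \<in> S" for i
    using that q by (auto simp: S_def intro!: power_increasing)
  have finS: "finite S"
    by (simp add: S_def)
  have "inj_on (\<lambda>i. q ^ i) {..<k}"
    using q by (intro inj_onI) simp
  then have cardS: "card S = k + 1"
    unfolding S_def using q by (subst card_insert_disjoint) (auto simp: card_image)
  have cardT: "card ?T = k + 1"
    using large by simp
  have subS: "S \<subseteq> {..<?Q}" and disj: "S \<inter> ?T = {}"
    using S_le m_less by fastforce+
  let ?R = "{..<?Q} - S - ?T"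
  have cardR: "card ?R = ?Q - (2 * k + 2)"
  proof -
    have "?R = {..<?Q} - (S \<union> ?T)"
      by blast
    then have "card ?R = card {..<?Q} - card (S \<union> ?T)"
      using subS finS by (simp add: card_Diff_subset subset_iff)
    then show ?thesis
      using disj finS cardS cardT by (simp add: card_Un_disjoint)
  qed
  \<comment> \<open>The largest element \<open>?m\<close> of \<open>S\<close> separates the two
    sets: both products are compared with the power of \<open>r ?m\<close> with exponent
    \<open>k + 1\<close>.\<close>
  have "(\<Prod>i\<in>S. r i) \<le> (\<Prod>i\<in>S. r ?m)"
    using S_le r2 subS m_less by (intro prod_mono conjI mono) (fastforce intro: order_trans[OF _ r2])+
  also have "\<dots> = (\<Prod>i\<in>?T. r ?m)"
    using cardS cardT by simp
  also have "\<dots> \<le> (\<Prod>i\<in>?T. r i)"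
    using r2[of ?m] m_less by (intro prod_mono conjI mono) auto
  finally have ST: "(\<Prod>i\<in>S. r i) \<le> (\<Prod>i\<in>?T. r i)" .
  have "(2::real) ^ k \<le> 2 ^ card ?R"
    using large cardR by (intro power_increasing) auto
  also have "\<dots> = (\<Prod>i\<in>?R. 2)"
    by simp
  also have "\<dots> \<le> (\<Prod>i\<in>?R. r i)"
    using r2 by (intro prod_mono) auto
  finally have R: "2 ^ k \<le> (\<Prod>i\<in>?R. r i)" .
  have subT: "?T \<subseteq> {..<?Q} - S"
    using disj by (auto simp: disjoint_iff)
  have S0: "0 \<le> (\<Prod>i\<in>S. r i)"
    using r2 subS by (intro prod_nonneg) (fastforce intro: order_trans[OF _ r2])
  have "(\<Prod>i\<in>S. r i)\<^sup>2 * 2 ^ k = (\<Prod>i\<in>S. r i) * ((\<Prod>i\<in>S. r i) * 2 ^ k)"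
    by (simp add: power2_eq_square)
  also have "\<dots> \<le> (\<Prod>i\<in>S. r i) * ((\<Prod>i\<in>?T. r i) * (\<Prod>i\<in>?R. r i))"
    using S0 ST R by (intro mult_left_mono mult_mono) auto
  also have "(\<Prod>i\<in>?T. r i) * (\<Prod>i\<in>?R. r i) = (\<Prod>i\<in>{..<?Q} - S. r i)"
    using prod.subset_diff[of ?T "{..<?Q} - S" r] subT by (simp add: mult.commute)
  also have "(\<Prod>i\<in>S. r i) * (\<Prod>i\<in>{..<?Q} - S. r i) = (\<Prod>i<?Q. r i)"
    using prod.subset_diff[of S "{..<?Q}" r] subS by (auto simp: mult.commute)
  also have "\<dots> = real (?N choose ?Q)"
    unfolding binomial_altdef_of_nat[OF QN] r_def lessThan_atLeast0
    using QN by (intro prod.cong) (auto simp: of_nat_diff)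
  finally show ?thesis .
qed

section \<open>Two small cases outside the general estimate\<close>

text \<open>For \<open>q = 4\<close>, \<open>k = 1\<close> the indices 0, 1 and 2, 3 use up all four
  factors, so \<open>large\<close> fails. The factor 2 is gained from the slack in
  \<open>x - 3\<close> against \<open>(x - 1) / 3\<close>.\<close>

lemma prod_ratio_sq_le_binomial_4_1:
  fixes N :: nat
  assumes N: "16 \<le> N"
  shows "(\<Prod>i\<in>insert 0 ((\<lambda>i. 4 ^ i) ` {..<1::nat}). (real N - real i) / (real (4 ^ 1) - real i))\<^sup>2 * 2
    \<le> real (N choose 4 ^ 1)"
proof -
  define x where "x = real N"
  have x: "16 \<le> x" using N by (simp add: x_def)
  have "real (N choose 4) = (\<Prod>i = 0..<4. (x - real i) / real (4 - i))"
    using N by (subst binomial_altdef_of_nat) (auto simp: x_def of_nat_diff intro!: prod.cong)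
  also have "\<dots> = (x / 4 * ((x - 1) / 3)) * ((x - 2) / 2 * (x - 3))"
    by (simp add: numeral_eq_Suc prod.atLeast0_lessThan_Suc)
  also have "\<dots> \<ge> (x / 4 * ((x - 1) / 3)) * (x / 4 * (2 * ((x - 1) / 3)))"
    using x by (intro mult_left_mono mult_mono) auto
  finally have "(x / 4 * ((x - 1) / 3))\<^sup>2 * 2 \<le> real (N choose 4)"
    by (simp only: power2_eq_square mult_ac)
  then show ?thesis
    by (simp add: lessThan_Suc x_def)
qed

text \<open>For \<open>q = 2\<close>, \<open>k = 3\<close> both \<open>gap\<close> and
  \<open>large\<close> fail: \<open>S\<close> is {0, 1, 2, 4} and no factor is left over. Matching
  0, 1, 2, 4 with 3, 5, 6, 7 in this order still works, and the last pair yields the factor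
  2.\<close>

lemma prod_ratio_sq_le_binomial_2_3:
  fixes N :: nat
  assumes N: "16 \<le> N"
  shows "(\<Prod>i\<in>insert 0 ((\<lambda>i. 2 ^ i) ` {..<3::nat}). (real N - real i) / (real (2 ^ 3) - real i))\<^sup>2 * 2
    \<le> real (N choose 2 ^ 3)"
proof -
  define x where "x = real N"
  have x: "16 \<le> x" using N by (simp add: x_def)
  have "real (N choose 8) = (\<Prod>i = 0..<8. (x - real i) / real (8 - i))"
    using N by (subst binomial_altdef_of_nat) (auto simp: x_def of_nat_diff intro!: prod.cong)
  also have "\<dots> = (x / 8 * ((x - 1) / 7) * ((x - 2) / 6) * ((x - 4) / 4)) *
      ((x - 3) / 5 * ((x - 5) / 3) * ((x - 6) / 2) * (x - 7))"
    by (simp add: numeral_eq_Suc prod.atLeast0_lessThan_Suc)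
  also have "\<dots> \<ge> (x / 8 * ((x - 1) / 7) * ((x - 2) / 6) * ((x - 4) / 4)) *
      (x / 8 * ((x - 1) / 7) * ((x - 2) / 6) * (2 * ((x - 4) / 4)))"
    using x by (intro mult_left_mono mult_mono mult_nonneg_nonneg) auto
  finally have "(x / 8 * ((x - 1) / 7) * ((x - 2) / 6) * ((x - 4) / 4))\<^sup>2 * 2 \<le> real (N choose 8)"
    by (simp only: power2_eq_square mult_ac)
  moreover have "insert 0 ((\<lambda>i. 2 ^ i) ` {..<3::nat}) = {0, 1, 2, 4 :: nat}"
    by (auto simp: lessThan_Suc numeral_3_eq_3)
  ultimately show ?thesis
    by (simp add: x_def mult_ac)
qed

text \<open>The exponent \<open>k - k0 + 1\<close> bounds the expected numbers of preserved flats by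
  1/2, 1/4, ..., a geometric series with sum below 1, so a single permutation works for all
  \<open>k\<close> at once.\<close>

lemma exists_bij_affinity_eq_0:
  assumes k0: "1 \<le> k0"
    and sq: "\<And>k. k0 \<le> k \<Longrightarrow> k < CARD('n) \<Longrightarrow>
      (\<Prod>i \<in> insert 0 ((\<lambda>i. CARD('a) ^ i) ` {..<k}).
        (real (CARD('a) ^ CARD('n)) - real i) / (real (CARD('a) ^ k) - real i))\<^sup>2 * 2 ^ (k - k0 + 1)
      \<le> real (CARD('a) ^ CARD('n) choose CARD('a) ^ k)"
  shows "\<exists>f :: 'a::{field,finite} ^ 'n \<Rightarrow> 'a ^ 'n. bij f \<and>
    (\<forall>k. k0 \<le> k \<and> k \<le> CARD('n) - 1 \<longrightarrow> affinity k f = 0)"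
proof -
  let ?K = "{k0..<CARD('n)}"
  let ?F = "\<lambda>k. {Z :: ('a ^ 'n) set. is_flat k Z}"
  have "2 \<le> CARD('a)"
    using card_mono[of "UNIV :: 'a set" "{0, 1}"] by simp
  then have le: "CARD('a) ^ k \<le> CARD('a ^ 'n)" if "k \<in> ?K" for k
    using that by (auto intro!: power_increasing)
  have bound: "real (card (?F k)) ^ 2 / real (CARD('a ^ 'n) choose CARD('a) ^ k) \<le> (1/2) ^ (k - k0 + 1)"
    if "k \<in> ?K" for k
  proof -
    let ?C = "real (CARD('a ^ 'n) choose CARD('a) ^ k)"
    have C: "0 < ?C"
      using le[OF that] by simp
    have "real (card (?F k)) ^ 2 * 2 ^ (k - k0 + 1) \<le> ?C"
      using that sq[of k] card_flats_le_prod[where 'a = 'a and 'n = 'n, of k, OF _ refl]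
      by (auto intro: order_trans[OF mult_right_mono[OF power_mono]])
    with C show ?thesis
      by (simp add: divide_simps mult.commute)
  qed
  have "(\<Sum>k\<in>?K. real (card (?F k)) ^ 2 / real (CARD('a ^ 'n) choose CARD('a) ^ k))
      \<le> (\<Sum>k\<in>?K. (1/2) ^ (k - k0 + 1))"
    using bound by (rule sum_mono)
  also have "\<dots> = (\<Sum>j<CARD('n) - k0. (1/2::real) ^ (j + 1))"
    by (rule sum.reindex_bij_witness[of _ "\<lambda>j. j + k0" "\<lambda>k. k - k0"]) auto
  also have "\<dots> = 1 - (1/2) ^ (CARD('n) - k0)"
  proof -
    have "(\<Sum>j<m. (1/2::real) ^ (j + 1)) = 1 - (1/2) ^ m" for m :: nat
      by (induction m) auto
    then show ?thesis .
  qed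
  also have "\<dots> < 1" by simp
  finally obtain f :: "'a ^ 'n \<Rightarrow> 'a ^ 'n" where f: "bij f" "\<forall>k\<in>?K. \<forall>Z\<in>?F k. f ` Z \<notin> ?F k"
    using exists_bij_avoiding[of ?K ?F "\<lambda>k. CARD('a) ^ k"] le card_flat by auto
  have "affinity k f = 0" if "k0 \<le> k" "k \<le> CARD('n) - 1" for k
  proof -
    have "k \<in> ?K" using that k0 by auto
    then have "{Z. is_flat k Z \<and> is_flat k (f ` Z)} = {}"
      using f(2) by blast
    then show ?thesis by (simp only: affinity_def card.empty)
  qed
  with f(1) show ?thesis by blast
qed

section \<open>The field of order \<open>q^n\<close>\<close>

text \<open>In an algebraically closed field of prime characteristic \<open>p\<close> and for
  \<open>m = p^n\<close> with \<open>n\<close> positive, this is the subfield of order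
  \<open>p^n\<close>.\<close>

definition power_fixed :: "nat \<Rightarrow> 'b::field set" where
  "power_fixed m = {x. x ^ m = x}"

lemma power_fixed_mult: "x \<in> power_fixed m \<Longrightarrow> y \<in> power_fixed m \<Longrightarrow> x * y \<in> power_fixed m"
  by (simp add: power_fixed_def power_mult_distrib)

lemma power_fixed_1: "1 \<in> power_fixed m"
  by (simp add: power_fixed_def)

lemma power_fixed_0: "0 < m \<Longrightarrow> 0 \<in> power_fixed m"
  by (simp add: power_fixed_def)

lemma power_fixed_power: "x \<in> power_fixed m \<Longrightarrow> x ^ j \<in> power_fixed m"
  by (induction j) (simp_all add: power_fixed_1 power_fixed_mult)

lemma power_fixed_inverse: "x \<in> power_fixed m \<Longrightarrow> inverse x \<in> power_fixed m"
  by (simp add: power_fixed_def power_inverse)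

lemma power_fixed_add:
  fixes x y :: "'b::field"
  assumes "prime CHAR('b)" "x \<in> power_fixed (CHAR('b) ^ n)" "y \<in> power_fixed (CHAR('b) ^ n)"
  shows "x + y \<in> power_fixed (CHAR('b) ^ n)"
  using assms by (simp add: power_fixed_def freshmans_dream')

text \<open>The elements are the roots of \<open>X^m - X\<close>, which splits into linear factors
  and has derivative -1, hence no repeated root.\<close>

lemma card_power_fixed:
  assumes n: "0 < n" and p: "prime CHAR('b::alg_closed_field)"
  shows "card (power_fixed (CHAR('b) ^ n) :: 'b set) = CHAR('b) ^ n"
proof -
  let ?m = "CHAR('b) ^ n"
  have m: "1 < ?m"
    using n p by (metis one_less_power prime_gt_1_nat)
  define P :: "'b poly" where "P = monom 1 ?m - monom 1 1"
  have deg: "degree P = ?m"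
    unfolding P_def diff_conv_add_uminus using m
    by (subst degree_add_eq_left) (auto simp: degree_monom_eq)
  have P0: "P \<noteq> 0"
    using deg m by (metis degree_0 not_less_zero)
  have "coeff P ?m = 1"
    using m by (simp add: P_def)
  then have lead: "lead_coeff P = 1"
    by (simp add: deg)
  have root: "poly P x = 0 \<longleftrightarrow> x \<in> power_fixed ?m" for x
    by (simp add: P_def poly_monom power_fixed_def)
  have "of_nat ?m = (0 :: 'b)"
    using n by (simp add: of_nat_eq_0_iff_char_dvd)
  then have deriv: "pderiv P = [:-1:]"
    by (simp add: P_def pderiv_diff pderiv_monom monom_0 del: of_nat_power)
  obtain A where A: "size A = ?m" "P = (\<Prod>x\<in>#A. [:-x, 1:])"
    using alg_closed_imp_factorization[OF P0] deg lead by auto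
  have le1: "count A x \<le> 1" for x
  proof (rule ccontr)
    assume "\<not> count A x \<le> 1"
    then have "{#x, x#} \<subseteq># A"
      by (auto simp: subseteq_mset_def)
    then obtain B where "A = {#x, x#} + B"
      by (metis mset_subset_eq_exists_conv)
    then have "P = [:-x, 1:] * ([:-x, 1:] * (\<Prod>y\<in>#B. [:-y, 1:]))"
      using A by simp
    then have "poly (pderiv P) x = 0"
      by (simp only: pderiv_mult poly_add poly_mult) simp
    with deriv show False by simp
  qed
  have "A = mset_set (set_mset A)"
  proof (rule multiset_eqI)
    fix x
    show "count A x = count (mset_set (set_mset A)) x"
    proof (cases "x \<in># A")
      case True
      then have "count A x = 1"
        using le1[of x] by (simp add: le_antisym)
      with True show ?thesis by simp
    qed (simp add: not_in_iff)
  qed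
  then have "card (set_mset A) = ?m"
    using A(1) by (metis size_mset_set)
  moreover have "set_mset A = power_fixed ?m"
  proof -
    have "poly P x = 0 \<longleftrightarrow> x \<in># A" for x
      unfolding A(2) by (induction A) auto
    then show ?thesis using root by auto
  qed
  ultimately show ?thesis by simp
qed

text \<open>Multiplication by a nonzero \<open>x\<close> permutes the nonzero elements; compare
  their products before and after.\<close>

lemma power_card_eq_same:
  fixes x :: "'a::{field,finite}"
  shows "x ^ CARD('a) = x"
proof (cases "x = 0")
  case False
  have "x ^ card (UNIV - {0 :: 'a}) * (\<Prod>y\<in>UNIV - {0}. y) = (\<Prod>y\<in>UNIV - {0}. x * y)"
    by (simp add: prod.distrib)
  also have "\<dots> = (\<Prod>y\<in>UNIV - {0}. y)"
    by (rule prod.reindex_bij_witness[of _ "\<lambda>y. y / x" "\<lambda>y. x * y"]) (use False in auto)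
  finally have "x ^ card (UNIV - {0 :: 'a}) = 1"
    by simp
  moreover have "Suc (card (UNIV - {0 :: 'a})) = CARD('a)"
    by (rule card_Suc_Diff1) auto
  ultimately show ?thesis
    by (metis mult.right_neutral power_Suc)
qed simp

lemma to_ac_in_power_fixed:
  "to_ac (c :: 'a::{field,finite}) \<in> power_fixed (CARD('a) ^ n)"
proof -
  have "c ^ CARD('a) ^ n = c"
    by (induction n) (simp_all add: power_card_eq_same power_mult)
  then show ?thesis
    by (simp add: power_fixed_def flip: to_ac_power)
qed

lemma CHAR_eq_CARD:
  assumes "prime CARD('a::{field,finite})"
  shows "CHAR('a) = CARD('a)"
proof -
  have "CHAR('a) = 1 \<or> CHAR('a) = CARD('a)"
    using assms CHAR_dvd_CARD[where 'a = 'a] unfolding prime_nat_iff by blast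
  then show ?thesis by simp
qed

text \<open>The subfield of order \<open>q^n\<close> is an \<open>n\<close>-dimensional space over
  the prime field \<open>'a\<close>, and \<phi> is the coordinate map of a basis. Primality gives
  \<open>CHAR('a) = CARD('a)\<close>.\<close>

lemma additive_bij_power_fixed:
  assumes p: "prime CARD('a::{field,finite})"
  obtains \<phi> :: "'a::{field,finite} ^ 'n \<Rightarrow> 'a alg_closure"
  where "bij_betw \<phi> UNIV (power_fixed (CARD('a) ^ CARD('n)))" "\<And>x y. \<phi> (x + y) = \<phi> x + \<phi> y"
proof -
  let ?F = "power_fixed (CARD('a) ^ CARD('n)) :: 'a alg_closure set"
  have char: "CHAR('a) = CARD('a)"
    using p by (rule CHAR_eq_CARD)
  interpret V: vector_space "\<lambda>(c::'a) x. to_ac c * x"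
    by unfold_locales (auto simp: algebra_simps)
  have add: "x + y \<in> ?F" if "x \<in> ?F" "y \<in> ?F" for x y
    using power_fixed_add[where 'b = "'a alg_closure"] that p by (simp add: char)
  have sub: "V.subspace ?F"
    unfolding V.subspace_def
    using add by (auto intro!: power_fixed_mult power_fixed_0 to_ac_in_power_fixed)
  have cardF: "card ?F = CARD('a) ^ CARD('n)"
    using card_power_fixed[where 'b = "'a alg_closure", of "CARD('n)"] p by (simp add: char)
  have finF: "finite ?F"
    using cardF by (intro card_ge_0_finite) simp
  obtain B where B: "B \<subseteq> ?F" "V.independent B" "?F \<subseteq> V.span B"
    by (rule V.basis_exists)
  have finB: "finite B"
    using B finF finite_subset by blast
  have span: "V.span B = ?F"
    using B sub by (simp add: V.span_minimal subset_antisym)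
  \<comment> \<open>The dimension is read off by comparing cardinalities, so the basis can be
    indexed by \<open>'n\<close>.\<close>
  have "CARD('a) ^ card B = CARD('a) ^ CARD('n)"
    using V.card_span_independent[OF finB B(2)] cardF span by simp
  then have cardB: "card B = CARD('n)"
    using p by (simp add: prime_gt_Suc_0_nat)
  then obtain b where b: "bij_betw b (UNIV :: 'n set) B"
    using finB by (metis finite_same_card_bij finite)
  define \<phi> where "\<phi> v = (\<Sum>i\<in>UNIV. to_ac (v $ i) * b i)" for v :: "'a ^ 'n"
  have "range \<phi> = V.span B"
  proof (intro equalityI subsetI)
    fix y assume "y \<in> range \<phi>"
    then show "y \<in> V.span B"
      using b by (auto simp: \<phi>_def bij_betw_def intro!: V.span_sum intro: V.span_scale V.span_base)
  next
    fix y assume "y \<in> V.span B"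
    then obtain u where "y = (\<Sum>x\<in>B. to_ac (u x) * x)"
      using V.span_finite[OF finB] by auto
    also have "\<dots> = \<phi> (\<chi> i. u (b i))"
      unfolding \<phi>_def using sum.reindex_bij_betw[OF b, of "\<lambda>x. to_ac (u x) * x"] by simp
    finally show "y \<in> range \<phi>" by blast
  qed
  then have ran: "range \<phi> = ?F"
    by (simp add: span)
  moreover have "inj \<phi>"
    using cardF ran by (intro eq_card_imp_inj_on) auto
  ultimately have "bij_betw \<phi> UNIV ?F"
    by (simp add: bij_betw_def)
  moreover have "\<phi> (x + y) = \<phi> x + \<phi> y" for x y
    by (simp add: \<phi>_def algebra_simps sum.distrib)
  ultimately show ?thesis by (rule that)
qed

section \<open>From flats to zero-sum sets\<close>

text \<open>Conjugate \<open>g\<close> by \<phi>. If \<open>Z\<close> and its image were both flats,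
  then \<phi> would carry them to a zero-sum set and its zero-sum image under \<open>g\<close>,
  which \<open>sum\<close> forbids.\<close>

lemma exists_bij_affinity_eq_0_if_sum:
  fixes \<phi> :: "'a::{field,finite} ^ 'n \<Rightarrow> 'b::ab_group_add"
  assumes \<phi>: "bij_betw \<phi> UNIV F" "\<And>x y. \<phi> (x + y) = \<phi> x + \<phi> y"
    and g: "bij_betw g F F"
    and flat: "\<And>Z. is_flat k (Z :: ('a ^ 'n) set) \<Longrightarrow> \<Sum>Z = 0"
    and sum: "\<And>Y. Y \<subseteq> F \<Longrightarrow> card Y = CARD('a) ^ k \<Longrightarrow> \<Sum>Y = 0 \<Longrightarrow> sum g Y \<noteq> 0"
  shows "\<exists>f :: 'a ^ 'n \<Rightarrow> 'a ^ 'n. bij f \<and> affinity k f = 0"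
proof -
  define f where "f = the_inv_into UNIV \<phi> \<circ> (g \<circ> \<phi>)"
  have inj: "inj \<phi>" and ran: "range \<phi> = F"
    using \<phi> by (auto simp: bij_betw_def)
  have f: "bij f"
    unfolding f_def
    by (intro bij_betw_trans[OF bij_betw_trans[OF \<phi>(1) g] bij_betw_the_inv_into[OF \<phi>(1)]])
  have \<phi>f: "\<phi> (f x) = g (\<phi> x)" for x
    unfolding f_def comp_def
    using g inj ran by (intro f_the_inv_into_f) (auto simp: bij_betw_def)
  have \<phi>0: "\<phi> 0 = 0"
    using \<phi>(2)[of 0 0] by simp
  have \<phi>sum: "\<phi> (\<Sum>x\<in>Z. h x) = (\<Sum>x\<in>Z. \<phi> (h x))" for Z and h :: "'a ^ 'n \<Rightarrow> 'a ^ 'n"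
    using \<phi>0 \<phi>(2) by (induction Z rule: infinite_finite_induct) auto
  have "\<not> is_flat k (f ` Z)" if "is_flat k Z" for Z
  proof
    assume fZ: "is_flat k (f ` Z)"
    have Z: "card Z = CARD('a) ^ k" "\<Sum>Z = 0" "\<Sum>(f ` Z) = 0"
      using flat card_flat that fZ by blast+
    have inj_f: "inj_on f Z" and inj_\<phi>: "inj_on \<phi> Z"
      using f inj by (auto dest: bij_is_inj intro: inj_on_subset)
    have "(\<Sum>x\<in>Z. f x) = 0"
      using Z(3) by (simp add: sum.reindex[OF inj_f])
    then have "sum g (\<phi> ` Z) = 0"
      using \<phi>sum[of f Z] \<phi>0 \<phi>f by (simp add: sum.reindex[OF inj_\<phi>])
    moreover have "\<Sum>(\<phi> ` Z) = 0"
      using \<phi>sum[of "\<lambda>x. x" Z] \<phi>0 Z(2) by (simp add: sum.reindex[OF inj_\<phi>])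
    moreover have "card (\<phi> ` Z) = CARD('a) ^ k"
      using Z(1) inj_\<phi> by (simp add: card_image)
    ultimately show False
      using sum[of "\<phi> ` Z"] ran by blast
  qed
  then have "{Z. is_flat k Z \<and> is_flat k (f ` Z)} = {}"
    by blast
  then have "affinity k f = 0"
    by (simp only: affinity_def card.empty)
  with f show ?thesis by blast
qed

text \<open>The plane is {x, x + u, x + v, x + u + v}, where every summand occurs an even number of
  times.\<close>

lemma sum_flat_2:
  fixes Z :: "('a::{field,finite} ^ 'n) set"
  assumes q: "CARD('a) = 2" and Z: "is_flat 2 Z"
  shows "\<Sum>Z = 0"
proof -
  have "CHAR('a) = 2"
    using CHAR_eq_CARD[where 'a = 'a] q by simp
  then have "x + x = 0" for x :: 'a
    using uminus_CHAR_2[of x] by (metis add.right_inverse)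
  then have two: "x + x = 0" for x :: "'a ^ 'n"
    by (simp add: vec_eq_iff)
  obtain U x where U: "vec.subspace U" "vec.dim U = 2" "Z = (\<lambda>u. u + x) ` U"
    using Z by (auto simp: is_flat_def)
  have card: "card U = 4"
    using card_subspace[OF U(1)] U(2) q by simp
  have "\<not> U \<subseteq> {0}"
    using card card_mono[of "{0}" U] by auto
  then obtain u where u: "u \<in> U" "u \<noteq> 0" by blast
  have "\<not> U \<subseteq> {0, u}"
    using card card_mono[of "{0, u}" U] u by auto
  then obtain v where v: "v \<in> U" "v \<noteq> 0" "v \<noteq> u" by blast
  have uv: "u + v \<noteq> 0" "u + v \<noteq> u" "u + v \<noteq> v"
    using u v two by (metis add.right_neutral add_left_cancel add_cancel_left_left)+
  have "{0, u, v, u + v} \<subseteq> U"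
    using U u v by (auto simp: vec.subspace_0 vec.subspace_add)
  moreover have "card {0, u, v, u + v} = 4"
    using u v uv by auto
  ultimately have "U = {0, u, v, u + v}"
    using card by (metis card_subset_eq finite)
  then have "\<Sum>Z = (\<Sum>w\<in>{0, u, v, u + v}. w + x)"
    using U(3) by (subst sum.reindex[symmetric, where h = "\<lambda>u. u + x", unfolded comp_def id_def]) auto
  also have "\<dots> = (u + u) + (v + v) + (x + x) + (x + x)"
    using u v uv by (auto simp: algebra_simps)
  finally show ?thesis
    by (simp add: two)
qed

text \<open>The line is {x, x + u, x - u}, with sum \<open>3 x\<close>.\<close>

lemma sum_flat_1:
  fixes Z :: "('a::{field,finite} ^ 'n) set"
  assumes q: "CARD('a) = 3" and Z: "is_flat 1 Z"
  shows "\<Sum>Z = 0"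
proof -
  have char: "CHAR('a) = 3"
    using CHAR_eq_CARD[where 'a = 'a] q by simp
  have "x + x + x = of_nat CHAR('a) * x" for x :: 'a
    by (simp add: char)
  then have "x + x + x = 0" for x :: 'a
    by simp
  then have three: "x + x + x = 0" for x :: "'a ^ 'n"
    by (simp add: vec_eq_iff)
  obtain U x where U: "vec.subspace U" "vec.dim U = 1" "Z = (\<lambda>u. u + x) ` U"
    using Z by (auto simp: is_flat_def)
  have card: "card U = 3"
    using card_subspace[OF U(1)] U(2) q by simp
  have "\<not> U \<subseteq> {0}"
    using card card_mono[of "{0}" U] by auto
  then obtain u where u: "u \<in> U" "u \<noteq> 0" by blast
  have "u + u \<noteq> 0"
    using u three by (metis add.left_neutral)
  then have uu: "u \<noteq> - u"
    by (metis add.right_inverse)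
  have "{0, u, - u} \<subseteq> U"
    using U u by (auto simp: vec.subspace_0 vec.subspace_neg)
  moreover have "card {0, u, - u} = 3"
    using u uu by auto
  ultimately have "U = {0, u, - u}"
    using card by (metis card_subset_eq finite)
  then have "\<Sum>Z = (\<Sum>w\<in>{0, u, - u}. w + x)"
    using U(3) by (subst sum.reindex[symmetric, where h = "\<lambda>u. u + x", unfolded comp_def id_def]) auto
  also have "\<dots> = x + x + x"
    using u uu by (simp add: add_ac)
  finally show ?thesis
    by (simp only: three)
qed

section \<open>Permutations destroying zero-sum sets\<close>

text \<open>Cubing is injective because for odd \<open>n\<close> the field has no nontrivial cube
  root of unity. Four distinct elements with sum 0 have cubes summing to
  \<open>(a + b) * (b + c) * (c + a)\<close>, which is nonzero in characteristic 2.\<close>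

lemma exists_bij_2_affinity_eq_0:
  assumes q: "CARD('a::{field,finite}) = 2" and n: "odd CARD('n)"
  shows "\<exists>f :: 'a ^ 'n \<Rightarrow> 'a ^ 'n. bij f \<and> affinity 2 f = 0"
proof -
  let ?F = "power_fixed (CARD('a) ^ CARD('n)) :: 'a alg_closure set"
  obtain \<phi> :: "'a ^ 'n \<Rightarrow> 'a alg_closure" where
    \<phi>: "bij_betw \<phi> UNIV ?F" "\<And>x y. \<phi> (x + y) = \<phi> x + \<phi> y"
    using additive_bij_power_fixed[where 'a = 'a and 'n = 'n] q by auto
  have finF: "finite ?F"
    using bij_betw_finite[OF \<phi>(1)] by simp
  have "CHAR('a alg_closure) = 2"
    using CHAR_eq_CARD[where 'a = 'a] q by simp
  then have neg: "- x = x" for x :: "'a alg_closure"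
    by (rule uminus_CHAR_2)
  have two: "2 = (0 :: 'a alg_closure)"
    using neg[of 1] by (metis add.right_inverse one_add_one)
  have cube: "x = y" if F: "x \<in> ?F" "y \<in> ?F" and eq: "x ^ 3 = y ^ 3" for x y
  proof (cases "y = 0")
    case False
    define t where "t = x * inverse y"
    have tF: "t \<in> ?F"
      unfolding t_def using F by (intro power_fixed_mult power_fixed_inverse)
    have t3: "t ^ 3 = 1"
      using False eq by (simp add: t_def power_mult_distrib power_inverse)
    have t4: "t ^ 4 = t"
      using t3 by (simp add: numeral_eq_Suc)
    \<comment> \<open>A cube root of unity is fixed by squaring twice, hence by any even number of
      squarings. Being fixed also by \<open>n\<close> squarings with \<open>n\<close> odd, it
      satisfies \<open>t = t^2\<close>.\<close>
    have even_pow: "t ^ (2 ^ (2 * m)) = t" for m :: nat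
    proof (induction m)
      case (Suc m)
      have "t ^ (2 ^ (2 * Suc m)) = (t ^ (2 ^ (2 * m))) ^ 4"
        by (simp add: mult.commute flip: power_mult)
      then show ?case using Suc t4 by simp
    qed simp
    obtain m where m: "CARD('n) = 2 * m + 1"
      using n by (rule oddE)
    have "t = t ^ (2 ^ CARD('n))"
      using tF q by (simp add: power_fixed_def)
    also have "\<dots> = (t ^ (2 ^ (2 * m)))\<^sup>2"
      by (simp add: m mult.commute flip: power_mult)
    finally have "t = t\<^sup>2"
      by (simp add: even_pow)
    moreover have "t \<noteq> 0"
      using t3 by auto
    ultimately have "t = 1"
      by (simp add: power2_eq_square)
    then show ?thesis
      using False by (simp add: t_def field_simps)
  qed (use eq in auto)
  have g: "bij_betw (\<lambda>x. x ^ 3) ?F ?F"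
  proof -
    have "inj_on (\<lambda>x. x ^ 3) ?F"
      using cube by (auto intro: inj_onI)
    moreover have "(\<lambda>x. x ^ 3) ` ?F \<subseteq> ?F"
      by (auto intro: power_fixed_power)
    ultimately show ?thesis
      using finF by (simp add: bij_betw_def endo_inj_surj)
  qed
  have sum: "(\<Sum>y\<in>Y. y ^ 3) \<noteq> 0" if "card Y = CARD('a) ^ 2" "\<Sum>Y = 0" for Y :: "'a alg_closure set"
  proof -
    have "card Y = Suc (Suc (Suc (Suc 0)))"
      using that q by simp
    then obtain a b c d where Y: "Y = {a, b, c, d}" "a \<notin> {b, c, d}" "b \<notin> {c, d}" "c \<noteq> d"
      by (auto simp: card_Suc_eq)
    have "a + (b + (c + d)) = 0"
      using that Y by simp
    then have d: "d = a + b + c"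
      using neg by (metis add.assoc minus_unique)
    have "(\<Sum>y\<in>Y. y ^ 3) = a ^ 3 + b ^ 3 + c ^ 3 + (a + b + c) ^ 3"
      using Y d by (simp add: add_ac)
    \<comment> \<open>Valid in any commutative ring, from the expansion of
      \<open>(a + b + c)^3\<close>; the multiple of 2 is split off to vanish.\<close>
    also have "\<dots> = (a + b) * (b + c) * (c + a) + 2 * (a ^ 3 + b ^ 3 + c ^ 3 + (a + b) * (b + c) * (c + a))"
      by (simp add: algebra_simps power3_eq_cube)
    also have "\<dots> = (a + b) * (b + c) * (c + a)"
      by (simp add: two)
    also have "\<dots> \<noteq> 0"
      using Y neg by (auto simp: add_eq_0_iff)
    finally show ?thesis .
  qed
  show ?thesis
    using exists_bij_affinity_eq_0_if_sum[OF \<phi> g sum_flat_2[OF q]] sum by blast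
qed

text \<open>Multiply by \<open>x * y * z\<close>. The second symmetric function is written so that
  \<open>y + z\<close> can be replaced when the sum is known.\<close>

lemma sum_inverse3_eq_0D:
  fixes x y z :: "'b::field"
  assumes "inverse x + inverse y + inverse z = 0" and nz: "x \<noteq> 0" "y \<noteq> 0" "z \<noteq> 0"
  shows "y * z + x * (y + z) = 0"
proof -
  have "y * z + x * (y + z) = (inverse x + inverse y + inverse z) * (x * y * z)"
    using nz by (simp add: field_simps)
  then show ?thesis
    using assms(1) by simp
qed

lemma exists_bij_1_affinity_eq_0:
  assumes q: "CARD('a::{field,finite}) = 3" and n: "2 \<le> CARD('n)"
  shows "\<exists>f :: 'a ^ 'n \<Rightarrow> 'a ^ 'n. bij f \<and> affinity 1 f = 0"
proof -
  let ?F = "power_fixed (CARD('a) ^ CARD('n)) :: 'a alg_closure set"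
  obtain \<phi> :: "'a ^ 'n \<Rightarrow> 'a alg_closure" where
    \<phi>: "bij_betw \<phi> UNIV ?F" "\<And>x y. \<phi> (x + y) = \<phi> x + \<phi> y"
    using additive_bij_power_fixed[where 'a = 'a and 'n = 'n] q by auto
  have finF: "finite ?F"
    using bij_betw_finite[OF \<phi>(1)] by simp
  have "card ?F = 3 ^ CARD('n)"
    using bij_betw_same_card[OF \<phi>(1)] q by simp
  moreover have "(3::nat) ^ 2 \<le> 3 ^ CARD('n)"
    using n by (intro power_increasing) auto
  ultimately have cardF: "9 \<le> card ?F" by simp
  have char: "CHAR('a alg_closure) = 3"
    using CHAR_eq_CARD[where 'a = 'a] q by simp
  then have three: "3 = (0 :: 'a alg_closure)"
    using of_nat_CHAR[where 'a = "'a alg_closure"] by simp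
  have "2 + 1 = (0 :: 'a alg_closure)"
    using three by simp
  then have "- 1 = (2 :: 'a alg_closure)"
    by (metis eq_neg_iff_add_eq_0)
  have one_neq: "(1 :: 'a alg_closure) \<noteq> - 1"
    using \<open>- 1 = 2\<close> by (metis one_add_one add_cancel_right_left zero_neq_one)
  have F1: "1 \<in> ?F" and F0: "0 \<in> ?F"
    using q by (auto intro: power_fixed_0 power_fixed_1)
  have Fadd: "x + y \<in> ?F" if "x \<in> ?F" "y \<in> ?F" for x y
    using power_fixed_add[of x "CARD('n)" y] that unfolding char q by simp
  have Fneg: "- x \<in> ?F" if "x \<in> ?F" for x
    using q that by (simp add: power_fixed_def power_minus_odd)
  \<comment> \<open>The pairs 1, -1 and \<open>t\<close>, \<open>- t\<close> have equal squares, so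
    at least two elements are nonsquares, and one of them differs from -1.\<close>
  have "\<exists>s\<in>?F. s \<noteq> - 1 \<and> (\<forall>d\<in>?F. d\<^sup>2 \<noteq> s)"
  proof (rule ccontr)
    assume neg: "\<not> ?thesis"
    have "\<not> ?F \<subseteq> {0, 1, - 1}"
    proof
      assume "?F \<subseteq> {0, 1, - 1}"
      then have "card ?F \<le> card {0, 1, - 1 :: 'a alg_closure}"
        by (rule card_mono[rotated]) simp
      also have "\<dots> \<le> 3"
        by (simp add: card_insert_if)
      finally show False
        using cardF by simp
    qed
    then obtain t where t: "t \<in> ?F" "t \<noteq> 0" "t \<noteq> 1" "t \<noteq> - 1" by blast
    have tt: "t \<noteq> - t"
      using one_neq t(2) by (metis mult_cancel_right mult_minus_left mult_1)
    have t1: "- t \<noteq> 1"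
      using t(4) by (metis minus_minus)
    let ?G = "?F - {- 1, - t}"
    have "d\<^sup>2 \<in> (\<lambda>d. d\<^sup>2) ` ?G" if d: "d \<in> ?F" for d
    proof -
      consider "d = - 1" | "d = - t" | "d \<in> ?G" using d by blast
      then show ?thesis
      proof cases
        case 1
        then show ?thesis using F1 one_neq t1 by (intro image_eqI[of _ _ 1]) auto
      next
        case 2
        then show ?thesis using tt t by (intro image_eqI[of _ _ t]) auto
      qed auto
    qed
    then have "card ((\<lambda>d. d\<^sup>2) ` ?F) \<le> card ?G"
      using finF by (intro surj_card_le[of _ _ "\<lambda>d. d\<^sup>2"]) auto
    moreover have "card ?G = card ?F - 2"
      using finF F1 t Fneg by (subst card_Diff_subset) auto
    moreover have "card ?F \<le> card (insert (- 1) ((\<lambda>d. d\<^sup>2) ` ?F))"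
      using neg finF by (intro card_mono) auto
    moreover have "card (insert (- 1) ((\<lambda>d. d\<^sup>2) ` ?F)) \<le> Suc (card ((\<lambda>d. d\<^sup>2) ` ?F))"
      using finF by (simp add: card_insert_if)
    ultimately show False
      using cardF by linarith
  qed
  then obtain s where s: "s \<in> ?F" "s \<noteq> - 1" "\<And>d. d \<in> ?F \<Longrightarrow> d\<^sup>2 \<noteq> s"
    by blast
  \<comment> \<open>The conditions on \<open>s\<close> make \<open>b\<close> differ from 0, 1 and
    -1: 0 and 1 are squares, and \<open>s\<close> is not \<open>-1 = 2\<close>.\<close>
  define b where "b = 1 - s"
  have b: "b \<in> ?F" "b \<noteq> 0" "b \<noteq> 1" "b \<noteq> - 1"
  proof -
    show "b \<in> ?F"
      unfolding b_def diff_conv_add_uminus using s F1 by (intro Fadd Fneg)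
    show "b \<noteq> 0" "b \<noteq> 1"
      using s(3)[OF F1] s(3)[OF F0] by (auto simp: b_def)
    show "b \<noteq> - 1"
      using s(2) \<open>- 1 = 2\<close> by (auto simp: b_def algebra_simps)
  qed
  \<comment> \<open>Inversion with 0 fixed has the values 0, 1, \<open>inverse b\<close> at 0, 1,
    \<open>b\<close>; here they are cycled.\<close>
  define g where "g x = (if x = 0 then 1 else if x = 1 then inverse b else if x = b then 0 else inverse x)" for x
  have g: "bij_betw g ?F ?F"
  proof -
    have "inj_on g ?F"
      using b by (auto simp: inj_on_def g_def split: if_splits)
    moreover have "g ` ?F \<subseteq> ?F"
      using b F0 F1 by (auto simp: g_def power_fixed_inverse)
    ultimately show ?thesis
      using finF by (simp add: bij_betw_def endo_inj_surj)
  qed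
  \<comment> \<open>Such a triple is {0, y, - y}. Its values sum to \<open>inverse b\<close> for
    \<open>y\<close> equal to 1 or -1, to \<open>1 - inverse b\<close> for \<open>b\<close> or
    \<open>- b\<close>, and to 1 otherwise.\<close>
  have zero: "g x + g y + g z \<noteq> 0" if xyz: "x = 0" "y \<noteq> x" "z \<noteq> x" "y \<noteq> z" "x + y + z = 0" for x y z
  proof -
    have z: "z = - y"
      using xyz by (simp add: add_eq_0_iff)
    have y: "y \<noteq> 0" "y \<noteq> - y"
      using xyz z by auto
    have "1 + g 1 + g (- 1) = inverse b"
      using b one_neq by (simp add: g_def)
    then have g1: "1 + g 1 + g (- 1) \<noteq> 0"
      using b by simp
    have "- b \<noteq> 1"
      using b by (metis minus_minus)
    then have gb: "1 + g b + g (- b) \<noteq> 0" if "b \<noteq> - b"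
      using b that by (simp add: g_def)
    consider "y = 1" | "y = - 1" | "y = b" | "y = - b" | "y \<notin> {0, 1, b}" "- y \<notin> {0, 1, b}"
      using y(1) by (metis empty_iff insert_iff minus_minus neg_equal_0_iff_equal)
    then have "1 + g y + g (- y) \<noteq> 0"
    proof cases
      case 1
      then show ?thesis using g1 by simp
    next
      case 2
      then show ?thesis using g1 by (simp add: add_ac)
    next
      case 3
      then show ?thesis using gb y by simp
    next
      case 4
      then show ?thesis using gb y by (simp add: add_ac)
    next
      case 5
      then show ?thesis by (simp add: g_def)
    qed
    then show ?thesis
      using xyz(1) z by (simp add: g_def)
  qed
  \<comment> \<open>The values \<open>inverse b\<close> and 0 would force \<open>z = - b\<close>,
    whereas the zero sum gives \<open>z = - 1 - b\<close>.\<close>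
  have one_b: "g x + g y + g z \<noteq> 0"
    if xyz: "x = 1" "y = b" "z \<noteq> x" "y \<noteq> z" "z \<noteq> 0" "x + y + z = 0" for x y z
  proof -
    have z: "z = - 1 - b" using xyz by (simp add: algebra_simps add_eq_0_iff)
    show ?thesis
    proof
      assume "g x + g y + g z = 0"
      then have "inverse b = - inverse z"
        using xyz b by (simp add: g_def add_eq_0_iff2)
      then have "b = - z"
        by (metis inverse_inverse_eq inverse_minus_eq)
      with z show False by simp
    qed
  qed
  have one: "g x + g y + g z \<noteq> 0"
    if xyz: "x = 1" "y \<notin> {0, 1, b}" "z \<notin> {0, 1, b}" "y \<noteq> z" "x + y + z = 0" "y \<in> ?F" for x y z
  proof
    assume "g x + g y + g z = 0"
    then have "inverse b + inverse y + inverse z = 0"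
      using xyz by (simp add: g_def)
    then have "y * z + b * (y + z) = 0"
      using b(2) xyz by (intro sum_inverse3_eq_0D) auto
    moreover have z: "z = - 1 - y"
      using xyz by (simp add: algebra_simps add_eq_0_iff)
    \<comment> \<open>Here the nonsquare enters: a vanishing sum of values would make
      \<open>s\<close> the square of \<open>y - 1\<close>.\<close>
    moreover have "(y + - 1)\<^sup>2 = s - 3 * y - (y * z + b * (y + z))"
      unfolding z b_def by (simp add: algebra_simps power2_eq_square)
    ultimately have "(y + - 1)\<^sup>2 = s"
      by (simp only: three) simp
    moreover have "y + - 1 \<in> ?F"
      using xyz F1 by (intro Fadd Fneg)
    ultimately show False
      using s(3) by blast
  qed
  have one': "g x + g y + g z \<noteq> 0"
    if "x = 1" "y \<notin> {0, 1}" "z \<notin> {0, 1}" "y \<noteq> z" "x + y + z = 0" "y \<in> ?F" for x y z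
  proof -
    consider "y = b" | "z = b" | "y \<noteq> b" "z \<noteq> b" by blast
    then show ?thesis
    proof cases
      case 1
      then show ?thesis using one_b[of x y z] that by simp
    next
      case 2
      then show ?thesis using one_b[of x z y] that by (simp add: add_ac)
    next
      case 3
      then show ?thesis using one[of x y z] that by simp
    qed
  qed
  \<comment> \<open>As \<open>g b = 0\<close>, the other two values would be opposite, giving
    \<open>y = - z\<close> and hence \<open>b = 0\<close>.\<close>
  have bb: "g x + g y + g z \<noteq> 0"
    if xyz: "x = b" "y \<notin> {0, 1, b}" "z \<notin> {0, 1, b}" "y \<noteq> z" "x + y + z = 0" for x y z
  proof
    assume "g x + g y + g z = 0"
    then have "inverse y = - inverse z"
      using xyz b by (simp add: g_def add_eq_0_iff2)
    then have "y = - z"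
      by (metis inverse_inverse_eq inverse_minus_eq)
    with xyz b show False by simp
  qed
  have gen: "g x + g y + g z \<noteq> 0"
    if xyz: "x \<notin> {0, 1, b}" "y \<notin> {0, 1, b}" "z \<notin> {0, 1, b}" "x \<noteq> y" "x + y + z = 0" for x y z
  proof
    assume "g x + g y + g z = 0"
    then have "inverse x + inverse y + inverse z = 0"
      using xyz by (simp add: g_def)
    then have "y * z + x * (y + z) = 0"
      using xyz by (intro sum_inverse3_eq_0D) auto
    moreover have z: "z = - x - y"
      using xyz by (simp add: algebra_simps add_eq_0_iff)
    \<comment> \<open>In characteristic 3 the second symmetric function of a zero-sum triple is
      minus a squared difference, so inversion preserves the zero sum of no triple of distinct
      nonzero elements.\<close>
    moreover have "(x - y)\<^sup>2 = - (y * z + x * (y + z)) - 3 * (x * y)"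
      unfolding z by (simp add: algebra_simps power2_eq_square)
    ultimately have "(x - y)\<^sup>2 = 0"
      by (simp only: three) simp
    then show False
      using xyz by simp
  qed
  have sum: "sum g Y \<noteq> 0" if "Y \<subseteq> ?F" "card Y = CARD('a) ^ 1" "\<Sum>Y = 0" for Y
  proof -
    have "card Y = Suc (Suc (Suc 0))"
      using that q by simp
    then obtain x y z where Y: "Y = {x, y, z}" "x \<noteq> y" "x \<noteq> z" "y \<noteq> z"
      by (auto simp: card_Suc_eq)
    have xyz: "x + y + z = 0" and F: "x \<in> ?F" "y \<in> ?F" "z \<in> ?F"
      using that Y by (auto simp: add_ac)
    have perm: "y + x + z = 0" "z + x + y = 0"
      "g y + g x + g z = g x + g y + g z" "g z + g x + g y = g x + g y + g z"
      using xyz by (simp_all add: add_ac)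
    have "g x + g y + g z \<noteq> 0"
    proof (cases "0 \<in> Y")
      case True
      then show ?thesis
        using zero[of x y z] zero[of y x z] zero[of z x y] Y xyz perm by force
    next
      case no0: False
      show ?thesis
      proof (cases "1 \<in> Y")
        case True
        then show ?thesis
          using one'[of x y z] one'[of y x z] one'[of z x y] Y F xyz perm no0 by force
      next
        case no1: False
        show ?thesis
        proof (cases "b \<in> Y")
          case True
          then show ?thesis
            using bb[of x y z] bb[of y x z] bb[of z x y] Y xyz perm no0 no1 by force
        next
          case False
          then show ?thesis
            using gen[of x y z] Y xyz no0 no1 by force
        qed
      qed
    qed
    then show ?thesis
      using Y by (simp add: add_ac)
  qed
  show ?thesis
    using exists_bij_affinity_eq_0_if_sum[OF \<phi> g sum_flat_1[OF q]] sum by blast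
qed

section \<open>Size conditions for each order of the field\<close>

theorem theorem2p1:
  shows
    "(CARD('a::{field,finite}) = 2 \<and> CARD('n::finite) \<ge> 3 \<and> odd CARD('n) \<longrightarrow>
        (\<exists>f :: 'a ^ 'n \<Rightarrow> 'a ^ 'n. bij f \<and> affinity 2 f = 0)) \<and>
     (CARD('a) = 2 \<and> CARD('n) \<ge> 4 \<longrightarrow>
        (\<exists>f :: 'a ^ 'n \<Rightarrow> 'a ^ 'n. bij f \<and>
           (\<forall>k. 3 \<le> k \<and> k \<le> CARD('n) - 1 \<longrightarrow> affinity k f = 0))) \<and>
     (CARD('a) \<ge> 4 \<and> CARD('n) \<ge> 2 \<longrightarrow>
        (\<exists>f :: 'a ^ 'n \<Rightarrow> 'a ^ 'n. bij f \<and>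
           (\<forall>k. 1 \<le> k \<and> k \<le> CARD('n) - 1 \<longrightarrow> affinity k f = 0))) \<and>
     (CARD('a) = 3 \<and> CARD('n) \<ge> 3 \<longrightarrow>
        (\<exists>f :: 'a ^ 'n \<Rightarrow> 'a ^ 'n. bij f \<and>
           (\<forall>k. 2 \<le> k \<and> k \<le> CARD('n) - 1 \<longrightarrow> affinity k f = 0))) \<and>
     (CARD('a) = 3 \<and> CARD('n) \<ge> 2 \<longrightarrow>
        (\<exists>f :: 'a ^ 'n \<Rightarrow> 'a ^ 'n. bij f \<and> affinity 1 f = 0))"
proof (intro conjI impI; elim conjE)
  let ?q = "CARD('a)" and ?n = "CARD('n)"
  let ?P = "\<lambda>k. \<Prod>i \<in> insert 0 ((\<lambda>i. ?q ^ i) ` {..<k}).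
    (real (?q ^ ?n) - real i) / (real (?q ^ k) - real i)"
  have generic: "(?P k)\<^sup>2 * 2 ^ (k - k0 + 1) \<le> real (?q ^ ?n choose ?q ^ k)"
    if "2 \<le> ?q" "1 \<le> k0" "k0 \<le> k" "k < ?n" "k + 2 \<le> ?q ^ k - ?q ^ (k - 1)" "3 * k + 2 \<le> ?q ^ k" for k k0
  proof -
    have "(?P k)\<^sup>2 * 2 ^ (k - k0 + 1) \<le> (?P k)\<^sup>2 * 2 ^ k"
      using that by (intro mult_left_mono power_increasing) auto
    also have "\<dots> \<le> real (?q ^ ?n choose ?q ^ k)"
      using that by (intro prod_ratio_sq_le_binomial) auto
    finally show ?thesis .
  qed
  show "\<exists>f :: 'a ^ 'n \<Rightarrow> 'a ^ 'n. bij f \<and> (\<forall>k. 3 \<le> k \<and> k \<le> ?n - 1 \<longrightarrow> affinity k f = 0)"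
    if q: "?q = 2" and n: "4 \<le> ?n"
  proof (rule exists_bij_affinity_eq_0)
    fix k assume k: "3 \<le> k" "k < ?n"
    \<comment> \<open>For \<open>q = 2\<close> the difference in \<open>gap\<close> is
      \<open>2^(k-1)\<close>, so the general estimate applies from \<open>k = 4\<close> on.\<close>
    have large: "3 * j + 2 \<le> 2 ^ j \<and> j + 2 \<le> 2 ^ (j - 1)" if "4 \<le> j" for j :: nat
      using that by (induction j rule: dec_induct) (auto simp: Suc_diff_le)
    show "(?P k)\<^sup>2 * 2 ^ (k - 3 + 1) \<le> real (?q ^ ?n choose ?q ^ k)"
    proof (cases "k = 3")
      case True
      have "(2::nat) ^ 4 \<le> 2 ^ ?n"
        using n by (intro power_increasing) auto
      then show ?thesis
        unfolding True q using prod_ratio_sq_le_binomial_2_3[of "2 ^ ?n"] by simp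
    next
      case False
      then have "(2::nat) ^ k = 2 ^ (k - 1) + 2 ^ (k - 1)"
        using k by (cases k) auto
      then show ?thesis
        using False k large[of k] q by (intro generic) auto
    qed
  qed simp
  \<comment> \<open>For \<open>q\<close> at least 3 the first bound propagates upwards from
    \<open>i\<close>. It implies the second because \<open>q^j - q^(j-1)\<close> is at least two
    thirds of \<open>q^j\<close>.\<close>
  have grow: "3 * j + 2 \<le> ?q ^ j \<and> j + 2 \<le> ?q ^ j - ?q ^ (j - 1)"
    if "3 \<le> ?q" "1 \<le> i" "3 * i + 2 \<le> ?q ^ i" "i \<le> j" for i j
  proof -
    have "3 * j + 2 \<le> ?q ^ j"
      using that(4)
    proof (induction j rule: dec_induct)
      case base
      then show ?case using that by simp
    next
      case (step m)
      have "3 * Suc m + 2 \<le> 3 * (3 * m + 2)"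
        by simp
      also have "\<dots> \<le> ?q * ?q ^ m"
        using step.IH that(1) by (rule mult_le_mono[rotated])
      finally show ?case by simp
    qed
    moreover have "3 * ?q ^ (j - 1) \<le> ?q ^ j"
      using that by (cases j) auto
    ultimately show ?thesis by linarith
  qed
  show "\<exists>f :: 'a ^ 'n \<Rightarrow> 'a ^ 'n. bij f \<and> (\<forall>k. 1 \<le> k \<and> k \<le> ?n - 1 \<longrightarrow> affinity k f = 0)"
    if q: "4 \<le> ?q" and n: "2 \<le> ?n"
  proof (rule exists_bij_affinity_eq_0)
    fix k assume k: "1 \<le> k" "k < ?n"
    show "(?P k)\<^sup>2 * 2 ^ (k - 1 + 1) \<le> real (?q ^ ?n choose ?q ^ k)"
    proof (cases "?q = 4 \<and> k = 1")
      case True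
      have "(4::nat) ^ 2 \<le> 4 ^ ?n"
        using n by (intro power_increasing) auto
      then show ?thesis
        using True prod_ratio_sq_le_binomial_4_1[of "4 ^ ?n"] by simp
    next
      case False
      have "4 ^ 2 \<le> ?q ^ 2"
        using q by (intro power_mono) auto
      \<comment> \<open>For \<open>k = 1\<close> the field has at least 5 elements here; for larger
        \<open>k\<close> the induction starts at 2, where 8 \<le> 16.\<close>
      then have "3 * k + 2 \<le> ?q ^ k \<and> k + 2 \<le> ?q ^ k - ?q ^ (k - 1)"
        using False q k grow[of 1 k] grow[of 2 k] by (cases "k = 1") auto
      then show ?thesis
        using q k by (intro generic) auto
    qed
  qed simp
  show "\<exists>f :: 'a ^ 'n \<Rightarrow> 'a ^ 'n. bij f \<and> (\<forall>k. 2 \<le> k \<and> k \<le> ?n - 1 \<longrightarrow> affinity k f = 0)"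
    if q: "?q = 3" and n: "3 \<le> ?n"
  proof (rule exists_bij_affinity_eq_0)
    fix k assume "2 \<le> k" "k < ?n"
    \<comment> \<open>The induction starts at \<open>k = 2\<close> with 8 \<le> 9.\<close>
    then show "(?P k)\<^sup>2 * 2 ^ (k - 2 + 1) \<le> real (?q ^ ?n choose ?q ^ k)"
      using q grow[of 2 k] by (intro generic) auto
  qed simp
qed (rule exists_bij_2_affinity_eq_0 exists_bij_1_affinity_eq_0; assumption)+

end
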